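(* Generalised geometric Cesàro convergence is dilation-invariant. That is, let $r\in\mathbb{R}_{>0}$, let $\gamma$ be a contour and let $\tilde\gamma:=r\gamma$ be the dilated contour. Let $f$ be a complex-valued function on $\tilde\gamma$ and let $g(z):=f(rz)$ for $z$ on $\gamma$. Then $g$ has a generalised Cesàro limit along $\gamma$ if and only if $f$ has a generalised Cesàro limit along $\tilde\gamma$, and in this case the two limits are equal (for every $L\in\mathbb{C}$, $g$ has generalised Cesàro limit $L$ along $\gamma$ if and only if $f$ has generalised Cesàro limit $L$ along $\tilde\gamma$).
   Context: A contour is a curve $\gamma:[0,\infty)\to\mathbb{C}$, $t\mapsto\gamma(t)$, parametrised by arc length $t$, starting at some $z_0\in\mathbb{C}$, with $\gamma(t)\to\infty$ as $t\to\infty$. The dilated contour $r\gamma$ is the curve with points $r\gamma(t)$, re-parametrised by its own arc length, i.e. $\tilde\gamma(u)=r\gamma(u/r)$. Generalised geometric Cesàro limit along a contour: let $f$ be a function on $\gamma$, regarded also as a function of $t$. Suppose that it can be written as $$f(t)=\sum_{j=1}^{n}a_j\,(\gamma(t))^{\rho_j}\,(\ln \gamma(t))^{m_j}+R(t)$$ for some finite collection of constants $a_j\in\mathbb{C}$, $\rho_j\in\mathbb{C}\setminus\{0\}$, $m_j\in\mathbb{Z}_{\ge 0}$ and some remainder function $R$. If there exists $N\in\mathbb{Z}_{\ge0}$ such that $P^{N}[R](t)\to L$ classically as $t\to\infty$, where $P$ is the averaging operator in arc length along $\gamma$, $$P[h](t)=\frac1t\int_0^t h(u)\,du,$$ then $f$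 is said to have generalised Cesàro limit $L$ along $\gamma$. Remainder functions are understood to be integrable on bounded intervals so that these averages make sense. The powers are $z^{\rho}=\exp(\rho\ln z)$, with the logarithms on $\gamma$ and $r\gamma$ chosen so that $\ln(rz)=\ln z+\ln r$ for $z$ on $\gamma$ (as holds for the principal branch). *)

theory Defs
  imports "HOL-Analysis.Analysis"
begin

text \<open>Length of the restriction of a curve to a compact interval: the supremum of the
  lengths of inscribed polygons.\<close>

definition arc_length :: "(real \<Rightarrow> complex) \<Rightarrow> real \<Rightarrow> real \<Rightarrow> ennreal" where
  "arc_length \<gamma> a b =
     (SUP xs \<in> {xs. sorted xs \<and> set xs \<subseteq> {a..b}}.
        \<Sum>i<length xs - 1. ennreal (dist (\<gamma> (xs ! i)) (\<gamma> (xs ! Suc i))))"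

text \<open>Curves are total functions on the reals; only their values on \<open>{0..}\<close> matter.\<close>

definition contour :: "(real \<Rightarrow> complex) \<Rightarrow> bool" where
  "contour \<gamma> \<longleftrightarrow>
     continuous_on {0..} \<gamma> \<and>
     (\<forall>t\<ge>0. arc_length \<gamma> 0 t = ennreal t) \<and>
     filterlim \<gamma> at_infinity at_top"

text \<open>The argument \<open>u / r\<close> makes the dilated curve parametrised by its own arc length again.\<close>

definition dilate :: "real \<Rightarrow> (real \<Rightarrow> complex) \<Rightarrow> real \<Rightarrow> complex" where
  "dilate r \<gamma> = (\<lambda>u. complex_of_real r * \<gamma> (u / r))"

text \<open>A choice of logarithm at every nonzero point of \<open>S\<close>. No continuity is required, so
  the restriction of the principal branch qualifies for every \<open>S\<close>.\<close>

definition log_on :: "(complex \<Rightarrow> complex) \<Rightarrow> complex set \<Rightarrow> bool" where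
  "log_on l S \<longleftrightarrow> (\<forall>z\<in>S - {0}. exp (l z) = z)"

definition locally_integrable :: "(real \<Rightarrow> complex) \<Rightarrow> bool" where
  "locally_integrable h \<longleftrightarrow> (\<forall>T\<ge>0. h absolutely_integrable_on {0..T})"

definition cesaro_mean :: "(real \<Rightarrow> complex) \<Rightarrow> real \<Rightarrow> complex" where
  "cesaro_mean h t = (1 / complex_of_real t) * (LINT u:{0..t}|lebesgue. h u)"

text \<open>\<open>l\<close> is the logarithm used on the contour; \<open>z\<close> to the power \<open>\<rho>\<close> is \<open>exp (\<rho> * l z)\<close>.
  Powers and logarithms are undefined at the origin, so the representation of \<open>f\<close> is only
  required at parameters with \<open>\<gamma> t \<noteq> 0\<close>; as \<open>\<gamma>\<close> is parametrised by arc length, the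
  exceptional parameters form a bounded null set. A Bochner integral of a non-integrable
  function is \<open>0\<close> by convention, so every function that is averaged is required to be
  integrable on bounded intervals (this is not automatic: the mean of an integrable function
  can fail to be integrable near \<open>0\<close>).\<close>

definition has_gen_cesaro_limit ::
  "(complex \<Rightarrow> complex) \<Rightarrow> (real \<Rightarrow> complex) \<Rightarrow> (complex \<Rightarrow> complex) \<Rightarrow> complex \<Rightarrow> bool" where
  "has_gen_cesaro_limit l \<gamma> f L \<longleftrightarrow>
     (\<exists>(n::nat) (a::nat \<Rightarrow> complex) (\<rho>::nat \<Rightarrow> complex) (m::nat \<Rightarrow> nat) (R::real \<Rightarrow> complex) (N::nat).
        (\<forall>j\<in>{1..n}. \<rho> j \<noteq> 0) \<and>
        (\<forall>t\<ge>0. \<gamma> t \<noteq> 0 \<longrightarrow>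
           f (\<gamma> t) = (\<Sum>j=1..n. a j * exp (\<rho> j * l (\<gamma> t)) * l (\<gamma> t) ^ m j) + R t) \<and>
        locally_integrable R \<and>
        (\<forall>k<N. locally_integrable ((cesaro_mean ^^ k) R)) \<and>
        ((cesaro_mean ^^ N) R \<longlongrightarrow> L) at_top)"

end

theory Submission
  imports Defs
begin

text \<open>
  Dilation by \<open>r\<close> turns the parameter \<open>t\<close> on \<open>\<gamma>\<close> into \<open>u = r t\<close> on \<open>r\<gamma>\<close>. Both ingredients of a
  generalised Cesaro limit survive this change of parameter.

  The averaging operator commutes with it: substituting \<open>v = c u\<close> in the integral gives
  \<open>P[h(c \<cdot>)](t) = 1/(c t) \<integral>\<^sub>0\<^bsup>ct\<^esup> h(v) dv = P[h](c t)\<close> (\<open>cesaro_mean_rescale\<close>), hence the same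
  holds for every iterate (\<open>cesaro_mean_iterate_rescale\<close>). The iterated means of the two remainders
  are therefore rescalings of each other and have the same limit at infinity.

  The exceptional terms keep their shape: the logarithm of a point of \<open>\<gamma>\<close> and that of its dilate
  differ by the constant \<open>ln r\<close>, and replacing \<open>w\<close> by \<open>w + c\<close> in a sum of terms
  \<open>a e\<^bsup>\<rho>w\<^esup> w\<^sup>m\<close> with \<open>\<rho> \<noteq> 0\<close> again gives such a sum, with the same exponents, by the binomial
  theorem (\<open>power_log_sum_shift\<close>).

  Together these show that a generalised limit along \<open>\<gamma>\<close> passes to the dilated curve
  (\<open>has_gen_cesaro_limit_dilate\<close>). The converse is the same fact applied to the dilation by \<open>1/r\<close>,
  which takes \<open>r\<gamma>\<close> back to \<open>\<gamma>\<close>.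
\<close>

lemma indicator_Icc_rescale:
  fixes c t x :: real
  assumes "c > 0"
  shows "indicator {0..c * t} (c * x) = (indicator {0..t} x :: real)"
  using assms by (simp add: indicator_def zero_le_mult_iff)

lemma set_integrable_rescale:
  fixes h :: "real \<Rightarrow> complex"
  assumes "c > 0" and "set_integrable lebesgue {0..c * t} h"
  shows "set_integrable lebesgue {0..t} (\<lambda>u. h (c * u))"
proof -
  have "integrable lebesgue (\<lambda>x. indicator {0..c * t} (0 + c * x) *\<^sub>R h (0 + c * x))"
    using assms lebesgue_integrable_real_affine_iff[of c "\<lambda>x. indicator {0..c * t} x *\<^sub>R h x" 0]
    by (simp add: set_integrable_def)
  then show ?thesis
    using assms(1) by (simp add: set_integrable_def indicator_Icc_rescale)
qed

lemma locally_integrable_rescale: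
  assumes "c > 0" and "locally_integrable h"
  shows "locally_integrable (\<lambda>u. h (c * u))"
  using assms unfolding locally_integrable_def by (simp add: set_integrable_rescale)

text \<open>Substitution \<open>v = c u\<close>, under which the Jacobian \<open>c\<close> cancels against the factor in
  \<open>1 / (c t)\<close>. Where \<open>h\<close> is not integrable both integrals are \<open>0\<close> by convention, and for \<open>t \<le> 0\<close>
  both sides vanish. Hence this is an equation between functions, which can be iterated.\<close>

lemma cesaro_mean_rescale:
  assumes "c > 0"
  shows "cesaro_mean (\<lambda>u. h (c * u)) = (\<lambda>t. cesaro_mean h (c * t))"
proof
  fix t
  have "(LINT u:{0..c * t}|lebesgue. h u) = complex_of_real c * (LINT u:{0..t}|lebesgue. h (c * u))"
    using assms lebesgue_integral_real_affine[of c "\<lambda>x. indicator {0..c * t} x *\<^sub>R h x" 0]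
    by (simp add: set_lebesgue_integral_def indicator_Icc_rescale scaleR_conv_of_real)
  with assms show "cesaro_mean (\<lambda>u. h (c * u)) t = cesaro_mean h (c * t)"
    by (simp add: cesaro_mean_def)
qed

lemma cesaro_mean_iterate_rescale:
  assumes "c > 0"
  shows "(cesaro_mean ^^ k) (\<lambda>u. h (c * u)) = (\<lambda>t. (cesaro_mean ^^ k) h (c * t))"
  using assms by (induction k) (simp_all add: cesaro_mean_rescale)

text \<open>Both sides are functions of the value \<open>w\<close> of the logarithm. Expanding \<open>(w + c) ^ m j\<close> gives
  one term for each pair \<open>(j, i)\<close> with \<open>i \<le> m j\<close>, all with the old exponent \<open>\<rho> j\<close>, so the new
  exponents are again nonzero. The pairs are then renumbered by an initial segment.\<close>

lemma power_log_sum_shift: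
  fixes a \<rho> :: "nat \<Rightarrow> complex" and m :: "nat \<Rightarrow> nat" and c :: complex
  assumes "\<forall>j\<in>{1..n}. \<rho> j \<noteq> 0"
  obtains n' a' \<rho>' m' where "\<forall>j\<in>{1..n'::nat}. \<rho>' j \<noteq> 0"
    and "\<And>w. (\<Sum>j=1..n. a j * exp (\<rho> j * (w + c)) * (w + c) ^ m j) =
              (\<Sum>j=1..n'. a' j * exp (\<rho>' j * w) * w ^ m' j)"
proof -
  define S where "S = Sigma {1..n} (\<lambda>j. {..m j})"
  define A where "A = (\<lambda>(j, i). a j * exp (\<rho> j * c) * of_nat (m j choose i) * c ^ (m j - i))"
  have "finite S"
    by (simp add: S_def)
  then obtain b where b: "bij_betw b {1..card S} S"
    using ex_bij_betw_nat_finite_1 by blast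
  show thesis
  proof (rule that)
    show "\<forall>k\<in>{1..card S}. (\<rho> \<circ> fst \<circ> b) k \<noteq> 0"
      using assms bij_betwE[OF b] by (fastforce simp: S_def)
    fix w
    have "(\<Sum>j=1..n. a j * exp (\<rho> j * (w + c)) * (w + c) ^ m j) =
          (\<Sum>j=1..n. \<Sum>i\<le>m j. A (j, i) * exp (\<rho> j * w) * w ^ i)"
      by (intro sum.cong refl)
        (simp add: A_def binomial_ring sum_distrib_left distrib_left exp_add mult_ac)
    also have "\<dots> = (\<Sum>p\<in>S. A p * exp (\<rho> (fst p) * w) * w ^ snd p)"
      unfolding S_def by (subst sum.Sigma) (auto intro!: sum.cong)
    also have "\<dots> = (\<Sum>k=1..card S. (A \<circ> b) k * exp ((\<rho> \<circ> fst \<circ> b) k * w) * w ^ (snd \<circ> b) k)"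
      using sum.reindex_bij_betw[OF b, symmetric] by simp
    finally show "(\<Sum>j=1..n. a j * exp (\<rho> j * (w + c)) * (w + c) ^ m j) = \<dots>" .
  qed
qed

text \<open>If \<open>R\<close> is the remainder of \<open>g\<close> on \<open>\<gamma>\<close>, then \<open>u \<mapsto> R (u / r)\<close> serves as the remainder of \<open>f\<close>
  on the dilated curve, with the same number of averages. The exceptional terms, written in \<open>l\<close>,
  are rewritten in \<open>l'\<close> by the shift with \<open>c = - ln r\<close>.\<close>

lemma has_gen_cesaro_limit_dilate:
  assumes "r > 0"
    and f: "\<And>t. t \<ge> 0 \<Longrightarrow> \<gamma> t \<noteq> 0 \<Longrightarrow> f (complex_of_real r * \<gamma> t) = g (\<gamma> t)"
    and l: "\<And>t. t \<ge> 0 \<Longrightarrow> \<gamma> t \<noteq> 0 \<Longrightarrow>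
              l' (complex_of_real r * \<gamma> t) = l (\<gamma> t) + complex_of_real (ln r)"
    and lim: "has_gen_cesaro_limit l \<gamma> g L"
  shows "has_gen_cesaro_limit l' (dilate r \<gamma>) f L"
proof -
  obtain n :: nat and a \<rho> :: "nat \<Rightarrow> complex" and m :: "nat \<Rightarrow> nat" and R N where
    \<rho>: "\<forall>j\<in>{1..n}. \<rho> j \<noteq> 0"
    and g: "\<And>t. t \<ge> 0 \<Longrightarrow> \<gamma> t \<noteq> 0 \<Longrightarrow>
       g (\<gamma> t) = (\<Sum>j=1..n. a j * exp (\<rho> j * l (\<gamma> t)) * l (\<gamma> t) ^ m j) + R t"
    and R: "locally_integrable R" "\<forall>k<N. locally_integrable ((cesaro_mean ^^ k) R)"
    and R_lim: "((cesaro_mean ^^ N) R \<longlongrightarrow> L) at_top"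
    using lim unfolding has_gen_cesaro_limit_def by blast
  obtain n' a' \<rho>' m' where \<rho>': "\<forall>j\<in>{1..n'::nat}. \<rho>' j \<noteq> 0"
    and shift: "\<And>w. (\<Sum>j=1..n. a j * exp (\<rho> j * (w + - complex_of_real (ln r))) *
                          (w + - complex_of_real (ln r)) ^ m j) =
                    (\<Sum>j=1..n'. a' j * exp (\<rho>' j * w) * w ^ m' j)"
    by (rule power_log_sum_shift[OF \<rho>, where a = a and m = m and c = "- complex_of_real (ln r)"])
      (rule that)
  define R' where "R' = (\<lambda>u. R (1 / r * u))"
  have inv_r: "1 / r > 0"
    using assms(1) by simp
  have iterate: "(cesaro_mean ^^ k) R' = (\<lambda>u. (cesaro_mean ^^ k) R (1 / r * u))" for k
    unfolding R'_def by (rule cesaro_mean_iterate_rescale[OF inv_r])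
  have expansion: "f (dilate r \<gamma> u) =
      (\<Sum>j=1..n'. a' j * exp (\<rho>' j * l' (dilate r \<gamma> u)) * l' (dilate r \<gamma> u) ^ m' j) + R' u"
    if "u \<ge> 0" "dilate r \<gamma> u \<noteq> 0" for u
  proof -
    have t: "u / r \<ge> 0" "\<gamma> (u / r) \<noteq> 0"
      using that assms(1) by (auto simp: dilate_def)
    have "l (\<gamma> (u / r)) = l' (dilate r \<gamma> u) + - complex_of_real (ln r)"
      using l[OF t] by (simp add: dilate_def)
    then show ?thesis
      using f[OF t] g[OF t] shift[of "l' (dilate r \<gamma> u)"] by (simp add: dilate_def R'_def)
  qed
  have "locally_integrable R'"
    unfolding R'_def by (rule locally_integrable_rescale[OF inv_r R(1)])
  moreover have "\<forall>k<N. locally_integrable ((cesaro_mean ^^ k) R')"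
    unfolding iterate using R(2) locally_integrable_rescale[OF inv_r] by blast
  moreover have "((cesaro_mean ^^ N) R' \<longlongrightarrow> L) at_top"
    unfolding iterate
    using R_lim filterlim_tendsto_pos_mult_at_top[OF tendsto_const inv_r filterlim_ident]
    by (rule filterlim_compose)
  ultimately show ?thesis
    unfolding has_gen_cesaro_limit_def using \<rho>' expansion
    by (intro exI[of _ n'] exI[of _ a'] exI[of _ \<rho>'] exI[of _ m'] exI[of _ R'] exI[of _ N]) simp
qed

theorem theorem1:
  fixes r :: real
    and \<gamma> :: "real \<Rightarrow> complex"
    and f :: "complex \<Rightarrow> complex"
    and ln\<^sub>1 ln\<^sub>2 :: "complex \<Rightarrow> complex"
  assumes "r > 0"
    and "contour \<gamma>"
    and "log_on ln\<^sub>1 (\<gamma> ` {0..})"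
    and "log_on ln\<^sub>2 (dilate r \<gamma> ` {0..})"
    and "\<And>z. z \<in> \<gamma> ` {0..} \<Longrightarrow> z \<noteq> 0 \<Longrightarrow>
           ln\<^sub>2 (complex_of_real r * z) = ln\<^sub>1 z + complex_of_real (ln r)"
  shows "((\<exists>L. has_gen_cesaro_limit ln\<^sub>1 \<gamma> (\<lambda>z. f (complex_of_real r * z)) L) \<longleftrightarrow>
          (\<exists>L. has_gen_cesaro_limit ln\<^sub>2 (dilate r \<gamma>) f L)) \<and>
         (\<forall>L. has_gen_cesaro_limit ln\<^sub>1 \<gamma> (\<lambda>z. f (complex_of_real r * z)) L \<longleftrightarrow>
              has_gen_cesaro_limit ln\<^sub>2 (dilate r \<gamma>) f L)"
proof -
  have "has_gen_cesaro_limit ln\<^sub>1 \<gamma> (\<lambda>z. f (complex_of_real r * z)) L \<longleftrightarrow>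
        has_gen_cesaro_limit ln\<^sub>2 (dilate r \<gamma>) f L" (is "?G \<longleftrightarrow> ?F") for L
  proof
    assume ?G
    then show ?F
      by (rule has_gen_cesaro_limit_dilate[OF \<open>r > 0\<close>, rotated 2]) (use assms(5) in auto)
  next
    assume ?F
    have "has_gen_cesaro_limit ln\<^sub>1 (dilate (1 / r) (dilate r \<gamma>)) (\<lambda>z. f (complex_of_real r * z)) L"
    proof (rule has_gen_cesaro_limit_dilate[OF _ _ _ \<open>?F\<close>])
      fix t :: real
      assume "t \<ge> 0" "dilate r \<gamma> t \<noteq> 0"
      then show "ln\<^sub>1 (complex_of_real (1 / r) * dilate r \<gamma> t) =
                 ln\<^sub>2 (dilate r \<gamma> t) + complex_of_real (ln (1 / r))"
        using \<open>r > 0\<close> assms(5)[of "\<gamma> (t / r)"] by (simp add: dilate_def ln_div)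
    qed (use \<open>r > 0\<close> in simp_all)
    moreover have "dilate (1 / r) (dilate r \<gamma>) = \<gamma>"
      using \<open>r > 0\<close> by (simp add: dilate_def fun_eq_iff)
    ultimately show ?G
      by simp
  qed
  then show ?thesis
    by simp
qed

end
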